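(* Assume that the comparison graph $\mathcal G$ on $n$ items is connected and that the sample size satisfies $N_{\mathrm{comp}}\ge\frac{c_2\operatorname{tr}(\tilde{\mathcal L}_A^\dagger)}{e^{2\kappa}\kappa^2}$, where $c_2>0$ is a universal constant. Then any estimator $\widetilde{\boldsymbol\theta}$ based on $N_{\mathrm{comp}}$ comparisons with outcomes from the Bradley–Terry–Luce (BTL) model satisfies $$\sup_{\boldsymbol\theta^*\in\Theta_\kappa}\mathbb E\left[\|\widetilde{\boldsymbol\theta}-\boldsymbol\theta^*\|_\infty^2\right]\gtrsim\frac{e^{-2\kappa}}{n\,N_{\mathrm{comp}}}\times\max\left\{n^2,\ \max_{n'\in\{2,\dots,n\}}\sum_{i=\lceil0.99n'\rceil}^{n'}[\lambda_i(\tilde{\mathcal L}_A)]^{-1}\right\},$$ where $\Theta_\kappa=\{\boldsymbol\theta\in\mathbb R^n:\mathbf 1_n^\top\boldsymbol\theta=0,\ \|\boldsymbol\theta\|_\infty\le\kappa\}$.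
   Context: The comparison graph $\mathcal G=([n],E)$ is an undirected simple graph; each edge is compared $L$ times, and $N_{\mathrm{comp}}=|E|L$ is the total number of comparisons. The two items in the $i$-th comparison are $(i_1,i_2)$ with $i_1<i_2$. The normalized graph Laplacian is $$\tilde{\mathcal L}_A=\frac1{N_{\mathrm{comp}}}\sum_{i=1}^{N_{\mathrm{comp}}}(\mathbf e_{i_1}-\mathbf e_{i_2})(\mathbf e_{i_1}-\mathbf e_{i_2})^\top,$$ where $\mathbf e_k$ is the $k$-th standard basis vector of $\mathbb R^n$. Its Moore–Penrose pseudo-inverse is $\tilde{\mathcal L}_A^\dagger$ and its eigenvalues are $0=\lambda_1(\tilde{\mathcal L}_A)\le\lambda_2(\tilde{\mathcal L}_A)\le\dots\le\lambda_n(\tilde{\mathcal L}_A)$. BTL model with parameter $\boldsymbol\theta^*$: the comparison outcomes are independent, and in a comparison of items $a$ and $b$, item $a$ beats $b$ with probability $1/(1+e^{-(\theta_a^*-\theta_b^* )})$. $\mathbf 1_n$ is the all-ones vector. $u\gtrsim v$ means $u\ge cv$ for a universal constant $c>0$. *)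

theory Defs
  imports "HOL-Probability.Product_PMF" "Jordan_Normal_Form.Char_Poly"
begin

text \<open>
  Items are \<open>0, \<dots>, n - 1\<close>. An undirected simple graph on the items is given by its set of edges,
  each edge being recorded once, as the pair \<open>(a, b)\<close> of its endpoints with \<open>a < b\<close>.
\<close>

definition simple_graph :: "nat \<Rightarrow> (nat \<times> nat) set \<Rightarrow> bool" where
  "simple_graph n E \<longleftrightarrow> E \<subseteq> {(a, b). a < b \<and> b < n}"

definition connected_graph :: "nat \<Rightarrow> (nat \<times> nat) set \<Rightarrow> bool" where
  "connected_graph n E \<longleftrightarrow> (\<forall>a<n. \<forall>b<n. (a, b) \<in> (E \<union> E\<inverse>)\<^sup>*)"

text \<open>
  The comparison \<open>((a, b), l)\<close> is the \<open>l\<close>-th comparison of the items \<open>a\<close> and \<open>b\<close>. This set replaces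
  the index set \<open>1, \<dots>, N\<close> of the comparisons.
\<close>

type_synonym comparison = "(nat \<times> nat) \<times> nat"

definition comparisons :: "(nat \<times> nat) set \<Rightarrow> nat \<Rightarrow> comparison set" where
  "comparisons E L = E \<times> {..<L}"

definition N_comp :: "(nat \<times> nat) set \<Rightarrow> nat \<Rightarrow> nat" where
  "N_comp E L = card E * L"

text \<open>The sum of the rank-one matrices \<open>(e\<^sub>a - e\<^sub>b) (e\<^sub>a - e\<^sub>b)\<^sup>T\<close> is written entrywise.\<close>

definition normalized_laplacian :: "nat \<Rightarrow> (nat \<times> nat) set \<Rightarrow> nat \<Rightarrow> real mat" where
  "normalized_laplacian n E L = mat n n (\<lambda>(j, k).
     1 / real (N_comp E L) *
     (\<Sum>((a, b), l)\<in>comparisons E L.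
        (unit_vec n a - unit_vec n b) $ j * (unit_vec n a - unit_vec n b) $ k))"

definition is_moore_penrose_inverse :: "real mat \<Rightarrow> real mat \<Rightarrow> bool" where
  "is_moore_penrose_inverse A X \<longleftrightarrow>
     X \<in> carrier_mat (dim_col A) (dim_row A) \<and>
     A * X * A = A \<and>
     X * A * X = X \<and>
     transpose_mat (A * X) = A * X \<and>
     transpose_mat (X * A) = X * A"

definition moore_penrose_inverse :: "real mat \<Rightarrow> real mat" where
  "moore_penrose_inverse A = (THE X. is_moore_penrose_inverse A X)"

definition mat_trace :: "real mat \<Rightarrow> real" where
  "mat_trace A = (\<Sum>i<dim_row A. A $$ (i, i))"

text \<open>
  The \<open>i\<close>-th smallest real eigenvalue, counted with algebraic multiplicity and numbered from \<open>1\<close>.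
  For a symmetric matrix of size \<open>n\<close> this lists the whole spectrum \<open>\<lambda>\<^sub>1 \<le> \<dots> \<le> \<lambda>\<^sub>n\<close>.
\<close>

definition nth_eigenvalue :: "real mat \<Rightarrow> nat \<Rightarrow> real" where
  "nth_eigenvalue A i = sorted_list_of_multiset (proots (char_poly A)) ! (i - 1)"

definition linf_norm :: "real vec \<Rightarrow> real" where
  "linf_norm v = Max ((\<lambda>i. \<bar>v $ i\<bar>) ` {..<dim_vec v})"

definition param_space :: "nat \<Rightarrow> real \<Rightarrow> real vec set" where
  "param_space n \<kappa> =
     {\<theta> \<in> carrier_vec n. vec n (\<lambda>_. 1) \<bullet> \<theta> = 0 \<and> linf_norm \<theta> \<le> \<kappa>}"

text \<open>
  An outcome assigns to the comparison \<open>((a, b), l)\<close> the value \<open>True\<close> iff \<open>a\<close> beats \<open>b\<close>; outside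
  \<open>comparisons E L\<close> it takes the dummy value \<open>False\<close>.
\<close>

definition BTL :: "(nat \<times> nat) set \<Rightarrow> nat \<Rightarrow> real vec \<Rightarrow> (comparison \<Rightarrow> bool) pmf" where
  "BTL E L \<theta> = Pi_pmf (comparisons E L) False
     (\<lambda>((a, b), l). bernoulli_pmf (1 / (1 + exp (- (\<theta> $ a - \<theta> $ b)))))"

definition linf_risk ::
  "(nat \<times> nat) set \<Rightarrow> nat \<Rightarrow> ((comparison \<Rightarrow> bool) \<Rightarrow> real vec) \<Rightarrow> real vec \<Rightarrow> real" where
  "linf_risk E L est \<theta> =
     measure_pmf.expectation (BTL E L \<theta>) (\<lambda>y. (linf_norm (est y - \<theta>))\<^sup>2)"

end

theory Submission
  imports Defs "Jordan_Normal_Form.Spectral_Radius"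
begin

text \<open>
  Write \<open>M\<close> for the normalized Laplacian, \<open>X\<close> for its pseudo-inverse and \<open>N\<close> for the number of
  comparisons. Both quantities in the maximum are bounded by a constant times \<open>tr X\<close>: the trace of
  \<open>X\<close> is the sum of all inverse nonzero eigenvalues (\<open>symmetric_moore_penrose\<close>), so it dominates every
  partial sum (\<open>eigenvalue_block_le_trace\<close>), and since the \<open>n - 1\<close> nonzero eigenvalues sum to \<open>tr M = 2\<close>,
  it is at least \<open>(n - 1)\<^sup>2 / 2\<close> (\<open>pinv_trace_lower\<close>). Hence it suffices to bound the worst-case risk from
  below by a multiple of \<open>exp (- 2 * \<kappa>) * tr X / (n * N)\<close>.

  This is Le Cam's two-point argument (\<open>two_point_bound\<close>). The chi-square divergence between the
  outcomes under \<open>0\<close> and under \<open>v\<close> is controlled by \<open>N v\<^sup>T M v\<close> (\<open>BTL_chi_square\<close>), because the logistic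
  function is Lipschitz and the comparisons are independent. If this number is bounded, no
  estimator distinguishes the two parameters, and the risk at one of them is of order \<open>(v\<^sub>k)\<^sup>2\<close> for
  every coordinate \<open>k\<close> (\<open>BTL_two_point_risk\<close>). The best direction for coordinate \<open>k\<close> is column \<open>k\<close> of
  \<open>X\<close>; normalized to \<open>N v\<^sup>T M v = exp (- 2 * \<kappa>)\<close> it has \<open>(v\<^sub>k)\<^sup>2 = exp (- 2 * \<kappa>) * X\<^sub>k\<^sub>k / N\<close>, and some
  \<open>X\<^sub>k\<^sub>k\<close> is at least \<open>tr X / n\<close>. By Cauchy-Schwarz every coordinate of \<open>v\<close> satisfies
  \<open>(v\<^sub>j)\<^sup>2 \<le> exp (- 2 * \<kappa>) * tr X / N\<close>, and the sample-size condition says exactly that this is at most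
  \<open>\<kappa>\<^sup>2\<close> (\<open>risk_lower_bound\<close>).

  The trace formula rests on the spectral theorem for real symmetric matrices
  (\<open>real_symmetric_diagonalization\<close>), proved by deflation with Householder reflections.
\<close>

(* Otherwise the component and inner product notations are ambiguous between two vector types. *)
unbundle no vec_syntax
unbundle no inner_syntax

section \<open>Two-point testing in the Bradley-Terry-Luce model\<close>

text \<open>
  Le Cam's method for two distributions. The sum of the two risks is at least \<open>s\<close> times the
  common mass \<open>\<Sum>y. min (P y) (Q y)\<close>. With \<open>r\<close> the density of \<open>Q\<close> with respect to \<open>P\<close>, this mass is
  the mean of \<open>min 1 r\<close> under \<open>P\<close>, and \<open>min 1 r \<ge> r - r\<^sup>2 / 4\<close> for \<open>r \<ge> 0\<close>. The mean of the
  right-hand side involves only the second moment of \<open>r\<close>, which factorizes for product distributions.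
\<close>
lemma two_point_bound:
  fixes P Q :: "'a pmf" and r f g :: "'a \<Rightarrow> real" and s :: real
  assumes fin: "finite (set_pmf P)"
    and density: "\<And>y. pmf Q y = pmf P y * r y"
    and f: "\<And>y. f y \<ge> 0" and g: "\<And>y. g y \<ge> 0"
    and sep: "\<And>y. f y + g y \<ge> s" and s: "s \<ge> 0"
  shows "measure_pmf.expectation P f + measure_pmf.expectation Q g
           \<ge> s * (1 - measure_pmf.expectation P (\<lambda>y. (r y)\<^sup>2) / 4)"
proof -
  define S where "S = set_pmf P"
  have S: "finite S" "set_pmf P \<subseteq> S" using fin by (auto simp: S_def)
  have SQ: "set_pmf Q \<subseteq> S"
    using density by (force simp: S_def set_pmf_eq)
  have EP: "measure_pmf.expectation P h = (\<Sum>y\<in>S. pmf P y * h y)" for h :: "'a \<Rightarrow> real"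
    using S by (subst integral_measure_pmf[of S]) auto
  have EQ: "measure_pmf.expectation Q h = (\<Sum>y\<in>S. pmf P y * (r y * h y))" for h :: "'a \<Rightarrow> real"
    using S(1) SQ by (subst integral_measure_pmf[of S]) (auto simp: density mult.assoc)
  have total: "(\<Sum>y\<in>S. pmf P y * r y) = 1"
    using EQ[of "\<lambda>_. 1"] by simp
  have "s * (1 - measure_pmf.expectation P (\<lambda>y. (r y)\<^sup>2) / 4) =
        (\<Sum>y\<in>S. pmf P y * (s * (r y - (r y)\<^sup>2 / 4)))"
  proof -
    have "(\<Sum>y\<in>S. pmf P y * (s * (r y - (r y)\<^sup>2 / 4))) =
      s * (\<Sum>y\<in>S. pmf P y * r y) - s * (\<Sum>y\<in>S. pmf P y * (r y)\<^sup>2) / 4"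
      by (simp add: sum_distrib_left sum_divide_distrib algebra_simps flip: sum_subtractf)
    then show ?thesis unfolding EP total by (simp add: algebra_simps)
  qed
  also have "\<dots> \<le> (\<Sum>y\<in>S. pmf P y * (f y + r y * g y))"
  proof (rule sum_mono)
    fix y assume "y \<in> S"
    then have pos: "pmf P y > 0" by (simp add: S_def pmf_positive)
    have r: "r y \<ge> 0"
      using density[of y] pos pmf_nonneg[of Q y] by (simp add: zero_le_mult_iff)
    have *: "s * (r y - (r y)\<^sup>2 / 4) \<le> f y + r y * g y"
    proof -
      define m where "m = min 1 (r y)"
      have m: "0 \<le> m" "m \<le> 1" "m \<le> r y" using r by (auto simp: m_def)
      \<comment> \<open>The quadratic stays below \<open>1\<close> because the gap is a square; it meets \<open>1\<close> at \<open>r = 2\<close>.\<close>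
      have "1 - (r y - (r y)\<^sup>2 / 4) = (r y / 2 - 1)\<^sup>2"
        by (simp add: power2_eq_square algebra_simps)
      then have "r y - (r y)\<^sup>2 / 4 \<le> m"
        unfolding m_def using zero_le_power2[of "r y / 2 - 1"] zero_le_power2[of "r y"]
        by (intro min.boundedI) linarith+
      then have "s * (r y - (r y)\<^sup>2 / 4) \<le> s * m" using s by (rule mult_left_mono)
      also have "\<dots> \<le> (f y + g y) * m" using sep m by (intro mult_right_mono) auto
      also have "\<dots> = m * f y + m * g y" by (simp add: algebra_simps)
      also have "\<dots> \<le> 1 * f y + r y * g y"
        using m f g by (intro add_mono mult_right_mono) auto
      finally show ?thesis by simp
    qed
    show "pmf P y * (s * (r y - (r y)\<^sup>2 / 4)) \<le> pmf P y * (f y + r y * g y)"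
      using * pos by (intro mult_left_mono) auto
  qed
  also have "\<dots> = measure_pmf.expectation P f + measure_pmf.expectation Q g"
    by (simp add: EP EQ algebra_simps sum.distrib)
  finally show ?thesis .
qed

definition win_prob :: "real vec \<Rightarrow> comparison \<Rightarrow> real" where
  "win_prob \<theta> = (\<lambda>((a, b), l). 1 / (1 + exp (- (\<theta> $ a - \<theta> $ b))))"

lemma win_prob_bounds: "0 \<le> win_prob \<theta> x" "win_prob \<theta> x \<le> 1"
  by (auto simp: win_prob_def divide_le_eq add_pos_pos split: prod.splits intro: add_nonneg_nonneg)

lemma BTL_eq: "BTL E L \<theta> = Pi_pmf (comparisons E L) False (\<lambda>x. bernoulli_pmf (win_prob \<theta> x))"
  unfolding BTL_def win_prob_def by (intro arg_cong[where f = "Pi_pmf _ _"]) (auto split: prod.splits)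

text \<open>
  Up to the factor \<open>N\<close>, this is the quadratic form of the normalized Laplacian at \<open>v\<close>.
\<close>
definition comparison_energy :: "(nat \<times> nat) set \<Rightarrow> nat \<Rightarrow> real vec \<Rightarrow> real" where
  "comparison_energy E L v = (\<Sum>((a, b), l)\<in>comparisons E L. (v $ a - v $ b)\<^sup>2)"

text \<open>
  Doubling the win probability and subtracting \<open>1\<close> gives \<open>tanh (t / 2)\<close>, and \<open>\<bar>tanh x\<bar> \<le> \<bar>x\<bar>\<close>
  because the derivative of \<open>tanh\<close> is at most \<open>1\<close>.
\<close>
lemma logistic_deviation:
  fixes t :: real
  shows "(2 * (1 / (1 + exp (- t))) - 1)\<^sup>2 \<le> t\<^sup>2 / 4"
proof -
  have eq: "2 * (1 / (1 + exp (- t))) - 1 = tanh (t / 2)" for t :: real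
    by (simp add: tanh_real_altdef field_simps add_pos_pos add_nonneg_eq_0_iff)
  have pos: "tanh x \<le> x" if "x \<ge> 0" for x :: real
  proof (cases "x = 0")
    case False
    have "x - tanh x \<ge> 0 - tanh 0"
    proof (rule DERIV_nonneg_imp_nondecreasing[OF that])
      fix y :: real
      have "((\<lambda>x. x - tanh x) has_real_derivative 1 - (1 - (tanh y)\<^sup>2)) (at y)"
        by (auto intro!: derivative_eq_intros)
      then show "\<exists>z. ((\<lambda>x. x - tanh x) has_real_derivative z) (at y) \<and> 0 \<le> z"
        by (intro exI[of _ "1 - (1 - (tanh y)\<^sup>2)"]) auto
    qed
    then show ?thesis by simp
  qed auto
  have "\<bar>tanh (t / 2)\<bar> \<le> \<bar>t / 2\<bar>"
    using pos[of "\<bar>t / 2\<bar>"] by (cases "t \<ge> 0") auto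
  then have "(tanh (t / 2))\<^sup>2 \<le> (t / 2)\<^sup>2" by (simp only: abs_le_square_iff)
  then show ?thesis unfolding eq by (simp add: power_divide)
qed

lemma simple_graph_finite: "simple_graph n E \<Longrightarrow> finite E"
  by (rule finite_subset[of _ "{..<n} \<times> {..<n}"]) (auto simp: simple_graph_def)

lemma simple_graph_finite_comparisons: "simple_graph n E \<Longrightarrow> finite (comparisons E L)"
  by (simp add: comparisons_def simple_graph_finite)

text \<open>
  At the parameter \<open>0\<close> every comparison is a fair coin toss, so the likelihood ratio is a product of
  factors \<open>2 q\<close> or \<open>2 (1 - q)\<close>, one per comparison, with \<open>q\<close> the win probability under \<open>\<theta>\<close>. By
  independence its second moment is the product of the factors \<open>1 + (2 q - 1)\<^sup>2 \<le> 1 + \<Delta>\<^sup>2 / 4\<close>, where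
  \<open>\<Delta>\<close> is the difference of the two scores.
\<close>
lemma BTL_chi_square:
  assumes E: "simple_graph n E"
  obtains r where "\<And>y. pmf (BTL E L \<theta>) y = pmf (BTL E L (0\<^sub>v n)) y * r y"
    and "measure_pmf.expectation (BTL E L (0\<^sub>v n)) (\<lambda>y. (r y)\<^sup>2) \<le> exp (comparison_energy E L \<theta> / 4)"
proof -
  define C where "C = comparisons E L"
  have C: "finite C" unfolding C_def by (rule simple_graph_finite_comparisons[OF E])
  define p where "p = win_prob \<theta>"
  define r where "r = (\<lambda>y. \<Prod>x\<in>C. 2 * pmf (bernoulli_pmf (p x)) (y x))"
  have p: "0 \<le> p x" "p x \<le> 1" for x by (auto simp: p_def win_prob_bounds)
  have fair: "BTL E L (0\<^sub>v n) = Pi_pmf C False (\<lambda>_. bernoulli_pmf (1/2))"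
    unfolding BTL_eq C_def
  proof (rule Pi_pmf_cong)
    fix x assume "x \<in> comparisons E L"
    then obtain a b l where "x = ((a, b), l)" "a < n" "b < n"
      using E by (fastforce simp: comparisons_def simple_graph_def)
    then have "win_prob (0\<^sub>v n) x = 1/2" by (simp add: win_prob_def)
    then show "bernoulli_pmf (win_prob (0\<^sub>v n) x) = bernoulli_pmf (1/2)" by (simp only:)
  qed auto
  have half: "pmf (bernoulli_pmf (1/2)) b = 1/2" for b by (cases b) auto
  have "pmf (BTL E L \<theta>) y = pmf (BTL E L (0\<^sub>v n)) y * r y" for y
  proof -
    have if_mult: "(if P then a else 0) = (if P then b else 0) * c" if "a = b * c" for P and a b c :: real
      using that by simp
    have "(\<Prod>x\<in>C. pmf (bernoulli_pmf (p x)) (y x)) =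
        (\<Prod>x\<in>C. 1 / 2) * (\<Prod>x\<in>C. 2 * pmf (bernoulli_pmf (p x)) (y x))"
      unfolding prod.distrib[symmetric] by (intro prod.cong) auto
    then show ?thesis
      unfolding fair unfolding BTL_eq C_def[symmetric] p_def[symmetric]
      unfolding pmf_Pi[OF C] half r_def by (rule if_mult)
  qed
  moreover have "measure_pmf.expectation (BTL E L (0\<^sub>v n)) (\<lambda>y. (r y)\<^sup>2) \<le> exp (comparison_energy E L \<theta> / 4)"
  proof -
    have "measure_pmf.expectation (BTL E L (0\<^sub>v n)) (\<lambda>y. (r y)\<^sup>2) =
      measure_pmf.expectation (Pi_pmf C False (\<lambda>_. bernoulli_pmf (1/2)))
        (\<lambda>y. \<Prod>x\<in>C. (2 * pmf (bernoulli_pmf (p x)) (y x))\<^sup>2)"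
      unfolding fair r_def prod_power_distrib ..
    also have "\<dots> = (\<Prod>x\<in>C. measure_pmf.expectation (bernoulli_pmf (1/2))
        (\<lambda>b. (2 * pmf (bernoulli_pmf (p x)) b)\<^sup>2))"
      using C by (intro expectation_prod_Pi_pmf integrable_measure_pmf_finite) auto
    also have "\<dots> = (\<Prod>x\<in>C. 1 + (2 * p x - 1)\<^sup>2)"
      using p by (intro prod.cong) (auto simp: power2_eq_square field_simps)
    also have "\<dots> \<le> (\<Prod>x\<in>C. exp (case x of ((a, b), l) \<Rightarrow> (\<theta> $ a - \<theta> $ b)\<^sup>2 / 4))"
    proof (intro prod_mono conjI)
      fix x :: comparison
      obtain a b l where x: "x = ((a, b), l)" by (metis surj_pair)
      have "1 + (2 * p x - 1)\<^sup>2 \<le> 1 + (\<theta> $ a - \<theta> $ b)\<^sup>2 / 4"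
        using logistic_deviation[of "\<theta> $ a - \<theta> $ b"] by (simp add: p_def win_prob_def x)
      also have "\<dots> \<le> exp ((\<theta> $ a - \<theta> $ b)\<^sup>2 / 4)" by (rule exp_ge_add_one_self)
      finally show "1 + (2 * p x - 1)\<^sup>2 \<le> exp (case x of ((a, b), l) \<Rightarrow> (\<theta> $ a - \<theta> $ b)\<^sup>2 / 4)"
        by (simp add: x)
    qed auto
    also have "\<dots> = exp (comparison_energy E L \<theta> / 4)"
      unfolding comparison_energy_def C_def[symmetric] sum_divide_distrib exp_sum[OF C]
      by (intro prod.cong) auto
    finally show ?thesis .
  qed
  ultimately show ?thesis using that by blast
qed

lemma linf_norm_ge: "k < dim_vec w \<Longrightarrow> \<bar>w $ k\<bar> \<le> linf_norm w"
  unfolding linf_norm_def by (intro Max_ge) auto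

lemma linf_norm_le:
  assumes "dim_vec w > 0" "\<And>k. k < dim_vec w \<Longrightarrow> \<bar>w $ k\<bar> \<le> B"
  shows "linf_norm w \<le> B"
  unfolding linf_norm_def using assms by (subst Max_le_iff) auto

text \<open>
  The two hypotheses \<open>0\<close> and \<open>v\<close> cannot be told apart reliably when the energy of \<open>v\<close> is bounded, and
  an estimator then errs by about \<open>v $ k\<close> in coordinate \<open>k\<close> under one of them. The bound \<open>4\<close> on the
  energy makes the second moment of the likelihood ratio at most \<open>exp 1 < 3\<close>.
\<close>
lemma BTL_two_point_risk:
  assumes E: "simple_graph n E" and est: "\<And>y. est y \<in> carrier_vec n"
    and v: "v \<in> carrier_vec n" and k: "k < n"
    and energy: "comparison_energy E L v \<le> 4"
  shows "linf_risk E L est (0\<^sub>v n) + linf_risk E L est v \<ge> (v $ k)\<^sup>2 / 8"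
proof -
  obtain r where r: "\<And>y. pmf (BTL E L v) y = pmf (BTL E L (0\<^sub>v n)) y * r y"
    and chi: "measure_pmf.expectation (BTL E L (0\<^sub>v n)) (\<lambda>y. (r y)\<^sup>2) \<le> exp (comparison_energy E L v / 4)"
    using BTL_chi_square[OF E] by blast
  note C = simple_graph_finite_comparisons[OF E, of L]
  have fin: "finite (set_pmf (BTL E L (0\<^sub>v n)))"
    unfolding BTL_eq by (rule finite_subset[OF set_Pi_pmf_subset'[OF C]]) (use C in auto)
  have sep: "(linf_norm (est y - 0\<^sub>v n))\<^sup>2 + (linf_norm (est y - v))\<^sup>2 \<ge> (v $ k)\<^sup>2 / 2" for y
  proof -
    have d: "dim_vec (est y) = n" "dim_vec v = n" using est[of y] v by auto
    have "(est y $ k)\<^sup>2 \<le> (linf_norm (est y - 0\<^sub>v n))\<^sup>2"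
      using power_mono[OF linf_norm_ge[of k "est y - 0\<^sub>v n"] abs_ge_zero, of 2] k d by simp
    moreover have "(est y $ k - v $ k)\<^sup>2 \<le> (linf_norm (est y - v))\<^sup>2"
      using power_mono[OF linf_norm_ge[of k "est y - v"] abs_ge_zero, of 2] k d by simp
    moreover have "(v $ k)\<^sup>2 / 2 \<le> (est y $ k)\<^sup>2 + (est y $ k - v $ k)\<^sup>2"
      using zero_le_power2[of "2 * est y $ k - v $ k"] by (simp add: power2_eq_square algebra_simps)
    ultimately show ?thesis by linarith
  qed
  have "exp (comparison_energy E L v / 4) \<le> exp 1" using energy by simp
  also have "\<dots> \<le> 3" by (rule exp_le)
  finally have "1 / 4 \<le> 1 - measure_pmf.expectation (BTL E L (0\<^sub>v n)) (\<lambda>y. (r y)\<^sup>2) / 4"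
    using chi by simp
  then have "(v $ k)\<^sup>2 / 2 * (1 / 4) \<le>
      (v $ k)\<^sup>2 / 2 * (1 - measure_pmf.expectation (BTL E L (0\<^sub>v n)) (\<lambda>y. (r y)\<^sup>2) / 4)"
    by (intro mult_left_mono) auto
  also have "\<dots> \<le> linf_risk E L est (0\<^sub>v n) + linf_risk E L est v"
    unfolding linf_risk_def by (intro two_point_bound fin r sep) auto
  finally show ?thesis by simp
qed

section \<open>Diagonalization and pseudo-inverse of real symmetric matrices\<close>

text \<open>
  The Householder matrix \<open>1 - c w w\<^sup>T\<close>; it is the reflection in the hyperplane orthogonal to \<open>w\<close> when
  \<open>c = 2 / \<parallel>w\<parallel>\<^sup>2\<close>, and the identity when \<open>c = 0\<close>.
\<close>
definition reflection_mat :: "nat \<Rightarrow> real \<Rightarrow> real vec \<Rightarrow> real mat" where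
  "reflection_mat n c w = mat n n (\<lambda>(i, j). (if i = j then 1 else 0) - c * w $ i * w $ j)"

lemma reflection_mat_involution:
  assumes "c = 0 \<or> c * (\<Sum>i<n. w $ i * w $ i) = 2"
  shows "reflection_mat n c w * reflection_mat n c w = 1\<^sub>m n"
proof (rule eq_matI)
  fix i j assume ij: "i < dim_row (1\<^sub>m n)" "j < dim_col (1\<^sub>m n)"
  have "(reflection_mat n c w * reflection_mat n c w) $$ (i, j) =
    (\<Sum>k<n. ((if i = k then 1 else 0) - c * w $ i * w $ k) * ((if k = j then 1 else 0) - c * w $ k * w $ j))"
    using ij by (simp add: reflection_mat_def scalar_prod_def atLeast0LessThan)
  also have "\<dots> = (\<Sum>k<n. (if i = k then (if i = j then 1 else 0) else 0)
      - (if i = k then c * w $ i * w $ j else 0) - (if k = j then c * w $ i * w $ j else 0)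
      + c * w $ i * w $ j * (c * (w $ k * w $ k)))"
    by (intro sum.cong) (auto simp: algebra_simps)
  also have "\<dots> = (if i = j then 1 else 0) - c * w $ i * w $ j - c * w $ i * w $ j
      + c * w $ i * w $ j * (c * (\<Sum>k<n. w $ k * w $ k))"
    using ij by (simp add: sum.distrib sum_subtractf sum_distrib_left)
  also have "\<dots> = (if i = j then 1 else 0)" using assms by auto
  finally show "(reflection_mat n c w * reflection_mat n c w) $$ (i, j) = 1\<^sub>m n $$ (i, j)" using ij by simp
qed (auto simp: reflection_mat_def)

text \<open>
  The reflection along \<open>v - e\<^sub>0\<close> swaps \<open>v\<close> and \<open>e\<^sub>0\<close>. It plays the part of completing a unit
  vector to an orthonormal basis, the columns of \<open>H\<close>.
\<close>
lemma reflection_onto_unit_vector: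
  fixes v :: "real vec"
  assumes v: "v \<in> carrier_vec n" and n: "n > 0" and unit: "v \<bullet> v = 1"
  obtains H where "H \<in> carrier_mat n n" "transpose_mat H = H" "H * H = 1\<^sub>m n" "col H 0 = v"
proof -
  define w where "w = v - unit_vec n 0"
  \<comment> \<open>\<open>\<parallel>w\<parallel>\<^sup>2 = 2 (1 - v\<^sub>0)\<close>; when \<open>v = e\<^sub>0\<close>, division by zero gives \<open>c = 0\<close> and \<open>H\<close> is the identity.\<close>
  define c where "c = 1 / (1 - v $ 0)"
  define H where "H = reflection_mat n c w"
  have w: "w $ i = v $ i - (if i = 0 then 1 else 0)" if "i < n" for i
    using v that by (simp add: w_def)
  have unit': "(\<Sum>i<n. v $ i * v $ i) = 1"
    using unit v by (simp add: scalar_prod_def atLeast0LessThan)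
  have rest: "v $ i = 0" if "v $ 0 = 1" "i < n" "i \<noteq> 0" for i
  proof -
    have "(\<Sum>k\<in>{..<n} - {0}. v $ k * v $ k) = 0"
      using unit' n that by (subst (asm) sum.remove[of _ 0]) auto
    then show ?thesis using that by (subst (asm) sum_nonneg_eq_0_iff) auto
  qed
  have "(\<Sum>i<n. w $ i * w $ i) = (\<Sum>i<n. v $ i * v $ i + (if i = 0 then 1 - 2 * v $ 0 else 0))"
    by (intro sum.cong) (auto simp: w algebra_simps)
  also have "\<dots> = 2 - 2 * v $ 0" using n by (simp add: sum.distrib unit')
  finally have ww: "(\<Sum>i<n. w $ i * w $ i) = 2 - 2 * v $ 0" .
  have "c = 0 \<or> c * (\<Sum>i<n. w $ i * w $ i) = 2"
    unfolding ww c_def by (cases "v $ 0 = 1") (auto simp: field_simps)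
  then have "H * H = 1\<^sub>m n" unfolding H_def by (rule reflection_mat_involution)
  moreover have "col H 0 = v"
  proof (rule eq_vecI)
    fix i assume "i < dim_vec v"
    then have i: "i < n" using v by auto
    show "col H 0 $ i = v $ i"
    proof (cases "v $ 0 = 1")
      case True
      then show ?thesis using i n rest[OF True i] by (auto simp: H_def reflection_mat_def c_def)
    next
      case False
      then have "c * w $ 0 = - 1" using n by (simp add: c_def w field_simps)
      then have "c * w $ i * w $ 0 = - w $ i" by (metis mult.commute mult.left_commute mult_minus1)
      then show ?thesis using i n by (simp add: H_def reflection_mat_def w)
    qed
  qed (use v in \<open>auto simp: H_def reflection_mat_def\<close>)
  moreover have "transpose_mat H = H" by (rule eq_matI) (auto simp: H_def reflection_mat_def)
  moreover have "H \<in> carrier_mat n n" by (simp add: H_def reflection_mat_def)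
  ultimately show ?thesis using that by blast
qed

text \<open>
  Over the complex numbers there is an eigenvector \<open>x\<close>, for an eigenvalue \<open>\<mu>\<close>. Symmetry makes
  \<open>x\<^sup>* A x = \<mu> \<parallel>x\<parallel>\<^sup>2\<close> equal to its own conjugate, so \<open>\<mu>\<close> is real; being a root of the real
  characteristic polynomial, it has a real eigenvector as well.
\<close>
lemma symmetric_real_eigenvalue:
  fixes A :: "real mat"
  assumes A: "A \<in> carrier_mat n n" and n: "n > 0" and sym: "transpose_mat A = A"
  obtains v r where "v \<in> carrier_vec n" "v \<bullet> v = 1" "A *\<^sub>v v = r \<cdot>\<^sub>v v"
proof -
  let ?A = "map_mat complex_of_real A"
  have cA: "?A \<in> carrier_mat n n" using A by simp
  have symA: "A $$ (i, j) = A $$ (j, i)" if "i < n" "j < n" for i j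
    using that A sym by (metis carrier_matD index_transpose_mat(1))
  obtain \<mu> where "eigenvalue ?A \<mu>"
    using spectrum_non_empty[OF cA] n by (auto simp: spectrum_def)
  then have root: "poly (char_poly ?A) \<mu> = 0" using eigenvalue_root_char_poly[OF cA] by simp
  obtain x where x: "x \<in> carrier_vec n" "x \<noteq> 0\<^sub>v n" "?A *\<^sub>v x = \<mu> \<cdot>\<^sub>v x"
    using \<open>eigenvalue ?A \<mu>\<close> cA by (auto simp: eigenvalue_def eigenvector_def)
  have Ax: "(\<Sum>j<n. complex_of_real (A $$ (i, j)) * x $ j) = \<mu> * x $ i" if "i < n" for i
  proof -
    have "(?A *\<^sub>v x) $ i = \<mu> * x $ i" using x that by simp
    then show ?thesis using A x(1) that by (simp add: scalar_prod_def atLeast0LessThan)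
  qed
  define q where "q = (\<Sum>i<n. cnj (x $ i) * x $ i)"
  define s where "s = (\<Sum>i<n. \<Sum>j<n. cnj (x $ i) * complex_of_real (A $$ (i, j)) * x $ j)"
  have "s = (\<Sum>i<n. cnj (x $ i) * (\<Sum>j<n. complex_of_real (A $$ (i, j)) * x $ j))"
    by (simp add: s_def sum_distrib_left mult.assoc)
  also have "\<dots> = \<mu> * q" by (simp add: Ax q_def sum_distrib_left mult.left_commute)
  finally have s: "s = \<mu> * q" .
  have "cnj s = (\<Sum>i<n. \<Sum>j<n. cnj (x $ j) * complex_of_real (A $$ (i, j)) * x $ i)"
    by (simp add: s_def ac_simps)
  also have "\<dots> = (\<Sum>j<n. \<Sum>i<n. cnj (x $ j) * complex_of_real (A $$ (i, j)) * x $ i)"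
    by (rule sum.swap)
  also have "\<dots> = s" unfolding s_def by (intro sum.cong refl) (auto simp: symA)
  finally have "cnj s = s" .
  have q: "q = complex_of_real (\<Sum>i<n. (cmod (x $ i))\<^sup>2)"
    unfolding q_def of_real_sum complex_norm_square by (simp add: mult.commute)
  have "q \<noteq> 0"
  proof
    assume "q = 0"
    then have "(\<Sum>i<n. (cmod (x $ i))\<^sup>2) = 0" unfolding q of_real_eq_0_iff .
    then have "\<forall>i<n. x $ i = 0" by (subst (asm) sum_nonneg_eq_0_iff) auto
    then have "x = 0\<^sub>v n" using x(1) by (intro eq_vecI) auto
    then show False using x(2) by simp
  qed
  moreover have "cnj q = q" by (simp add: q)
  ultimately have "cnj \<mu> = \<mu>" using \<open>cnj s = s\<close> unfolding s by simp
  then obtain r where mu: "\<mu> = complex_of_real r"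
    using Reals_cnj_iff Reals_cases by metis
  have "poly (map_poly complex_of_real (char_poly A)) (complex_of_real r) = 0"
    using root by (simp only: mu of_real_hom.char_poly_hom[OF A])
  then have "poly (char_poly A) r = 0"
    by (simp only: of_real_hom.poly_map_poly of_real_eq_0_iff)
  then have "eigenvalue A r" using eigenvalue_root_char_poly[OF A] by simp
  then obtain u where u: "u \<in> carrier_vec n" "u \<noteq> 0\<^sub>v n" "A *\<^sub>v u = r \<cdot>\<^sub>v u"
    using A by (auto simp: eigenvalue_def eigenvector_def)
  have uu: "u \<bullet> u = (\<Sum>i<n. (u $ i)\<^sup>2)"
    using u(1) by (simp add: scalar_prod_def atLeast0LessThan power2_eq_square)
  have "u \<bullet> u \<noteq> 0"
  proof
    assume "u \<bullet> u = 0"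
    then have "\<forall>i<n. u $ i = 0" unfolding uu by (subst (asm) sum_nonneg_eq_0_iff) auto
    then have "u = 0\<^sub>v n" using u(1) by (intro eq_vecI) auto
    then show False using u(2) by simp
  qed
  moreover have "u \<bullet> u \<ge> 0" unfolding uu by (intro sum_nonneg) auto
  ultimately have "u \<bullet> u > 0" by simp
  define v where "v = (1 / sqrt (u \<bullet> u)) \<cdot>\<^sub>v u"
  have "v \<bullet> v = 1" using u(1) \<open>u \<bullet> u > 0\<close> by (simp add: v_def)
  moreover have "A *\<^sub>v v = r \<cdot>\<^sub>v v"
    using u A by (simp add: v_def mult_mat_vec smult_smult_assoc mult.commute)
  moreover have "v \<in> carrier_vec n" using u(1) by (simp add: v_def)
  ultimately show ?thesis using that by blast
qed

text \<open>
  The spectral theorem. Once a unit eigenvector is reflected onto \<open>e\<^sub>0\<close>, the first column vanishes off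
  the diagonal, hence so does the first row, and the remaining block is again symmetric. The
  eigenvector basis is orthogonal, so its transpose is the inverse change of basis.
\<close>
theorem real_symmetric_diagonalization:
  fixes A :: "real mat"
  assumes "A \<in> carrier_mat n n" and "transpose_mat A = A"
  shows "\<exists>U D. similar_mat_wit A D U (transpose_mat U) \<and> diagonal_mat D"
  using assms
proof (induction n arbitrary: A)
  case 0
  then have "similar_mat_wit A A A (transpose_mat A)" "diagonal_mat A"
    by (auto simp: similar_mat_wit_def Let_def diagonal_mat_def intro!: eq_matI)
  then show ?case by blast
next
  case (Suc m)
  note A = Suc.prems(1) and sym = Suc.prems(2)
  obtain v r where v: "v \<in> carrier_vec (Suc m)" "v \<bullet> v = 1" "A *\<^sub>v v = r \<cdot>\<^sub>v v"
    using symmetric_real_eigenvalue[OF A _ sym] by auto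
  obtain H where H: "H \<in> carrier_mat (Suc m) (Suc m)" "transpose_mat H = H"
      "H * H = 1\<^sub>m (Suc m)" "col H 0 = v"
    using reflection_onto_unit_vector[OF v(1) _ v(2)] by auto
  define B where "B = H * A * H"
  have B: "B \<in> carrier_mat (Suc m) (Suc m)" using H A by (simp add: B_def)
  have "H * B * H = (H * H) * A * (H * H)"
    using H(1) A by (simp add: B_def assoc_mult_mat[of _ "Suc m" "Suc m" _ "Suc m" _ "Suc m"])
  then have AB: "similar_mat_wit A B H H"
    using H A B by (intro similar_mat_witI[of _ _ "Suc m"]) auto
  have "transpose_mat B = B"
    using H A sym by (simp add: B_def transpose_mult[of _ "Suc m" "Suc m" _ "Suc m"])
  then have symB: "B $$ (i, j) = B $$ (j, i)" if "i < Suc m" "j < Suc m" for i j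
    using that B by (metis carrier_matD index_transpose_mat(1))
  have "col B 0 = (H * A) *\<^sub>v col H 0"
    unfolding B_def using H(1) A by (intro col_mult2) auto
  also have "\<dots> = H *\<^sub>v (A *\<^sub>v v)"
    unfolding H(4) using H(1) A v(1) by (intro assoc_mult_mat_vec) auto
  also have "\<dots> = r \<cdot>\<^sub>v (H *\<^sub>v col H 0)"
    unfolding v(3) H(4) using H(1) v(1) by (intro mult_mat_vec) auto
  also have "H *\<^sub>v col H 0 = col (H * H) 0"
    using H(1) by (intro col_mult2[symmetric]) auto
  finally have "col B 0 = r \<cdot>\<^sub>v unit_vec (Suc m) 0" by (simp add: H(3))
  then have B0: "B $$ (i, 0) = (if i = 0 then r else 0)" if "i < Suc m" for i
    using that B by (metis (no_types, lifting) index_col carrier_matD zero_less_Suc index_smult_vec(1)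
        index_unit_vec(1,3) mult.right_neutral mult_zero_right)
  define C where "C = mat m m (\<lambda>(i, j). B $$ (Suc i, Suc j))"
  define R where "R = mat 1 1 (\<lambda>_. r)"
  have B_block: "B = four_block_mat R (0\<^sub>m 1 m) (0\<^sub>m m 1) C"
  proof (rule eq_matI)
    fix i j assume "i < dim_row (four_block_mat R (0\<^sub>m 1 m) (0\<^sub>m m 1) C)" "j < dim_col (four_block_mat R (0\<^sub>m 1 m) (0\<^sub>m m 1) C)"
    then have "i < Suc m" "j < Suc m" by (auto simp: R_def C_def)
    then show "B $$ (i, j) = four_block_mat R (0\<^sub>m 1 m) (0\<^sub>m m 1) C $$ (i, j)"
      using B0[of i] B0[of j] symB[of 0 j] by (auto simp: R_def C_def)
  qed (use B in \<open>auto simp: R_def C_def\<close>)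
  have "C \<in> carrier_mat m m" by (simp add: C_def)
  moreover have "transpose_mat C = C" by (rule eq_matI) (auto simp: C_def symB)
  ultimately obtain Q D where Q: "similar_mat_wit C D Q (transpose_mat Q)" and D: "diagonal_mat D"
    using Suc.IH by blast
  have carr: "C \<in> carrier_mat m m" "D \<in> carrier_mat m m" "Q \<in> carrier_mat m m"
    using Q by (auto simp: similar_mat_wit_def Let_def C_def)
  let ?U = "four_block_mat (1\<^sub>m 1) (0\<^sub>m 1 m) (0\<^sub>m m 1) Q"
  let ?D = "four_block_mat R (0\<^sub>m 1 m) (0\<^sub>m m 1) D"
  have "transpose_mat ?U = four_block_mat (1\<^sub>m 1) (0\<^sub>m 1 m) (0\<^sub>m m 1) (transpose_mat Q)"
    using carr by (subst transpose_four_block_mat[of _ 1 1 _ m _ m]) auto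
  moreover have "similar_mat_wit B ?D ?U (four_block_mat (1\<^sub>m 1) (0\<^sub>m 1 m) (0\<^sub>m m 1) (transpose_mat Q))"
    unfolding B_block
    by (rule similar_mat_wit_four_block[OF similar_mat_wit_refl Q])
       (use carr in \<open>auto simp: R_def\<close>)
  ultimately have BD: "similar_mat_wit B ?D ?U (transpose_mat ?U)" by simp
  have "transpose_mat (H * ?U) = transpose_mat ?U * H"
    using H carr by (subst transpose_mult[of _ "Suc m" "Suc m" _ "Suc m"]) auto
  then have "similar_mat_wit A ?D (H * ?U) (transpose_mat (H * ?U))"
    using similar_mat_wit_trans[OF AB BD] by simp
  moreover have "diagonal_mat ?D"
    using D carr by (auto simp: diagonal_mat_def R_def)
  ultimately show ?case by blast
qed

text \<open>
  The four Penrose equations give \<open>A X = A Y\<close> and \<open>X A = Y A\<close>: each product is a symmetric idempotent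
  that absorbs the other one, and transposition reverses the order of absorption. Hence
  \<open>X = X A X = Y A Y = Y\<close>.
\<close>
lemma moore_penrose_unique:
  assumes X: "is_moore_penrose_inverse A X" and Y: "is_moore_penrose_inverse A Y"
  shows "X = Y"
proof -
  define m n where "m = dim_row A" and "n = dim_col A"
  have A: "A \<in> carrier_mat m n" by (simp add: m_def n_def)
  have carr: "X \<in> carrier_mat n m" "Y \<in> carrier_mat n m"
    using X Y by (auto simp: is_moore_penrose_inverse_def m_def n_def)
  note X = X[unfolded is_moore_penrose_inverse_def] and Y = Y[unfolded is_moore_penrose_inverse_def]
  have AYX: "(A * Y) * (A * X) = A * X"
  proof -
    have "(A * Y) * (A * X) = (A * Y * A) * X"
      using A carr by (intro assoc_mult_mat[of _ m m _ n _ m, symmetric]) auto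
    then show ?thesis using Y by (simp only:)
  qed
  have "A * X = transpose_mat ((A * Y) * (A * X))" unfolding AYX using X by simp
  also have "\<dots> = transpose_mat (A * X) * transpose_mat (A * Y)"
    using A carr by (intro transpose_mult[of _ m m _ m]) auto
  also have "\<dots> = (A * X) * (A * Y)" using X Y by simp
  also have "\<dots> = (A * X * A) * Y"
    using A carr by (intro assoc_mult_mat[of _ m m _ n _ m, symmetric]) auto
  finally have AXY: "A * X = A * Y" using X by (simp only:)
  have XYA: "(X * A) * (Y * A) = X * A"
  proof -
    have "(X * A) * (Y * A) = X * (A * (Y * A))"
      using A carr by (intro assoc_mult_mat[of _ n m _ n _ n]) auto
    also have "A * (Y * A) = A * Y * A"
      using A carr by (intro assoc_mult_mat[of _ m n _ m _ n, symmetric]) auto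
    finally show ?thesis using Y by (simp only:)
  qed
  have "X * A = transpose_mat ((X * A) * (Y * A))" unfolding XYA using X by simp
  also have "\<dots> = transpose_mat (Y * A) * transpose_mat (X * A)"
    using A carr by (intro transpose_mult[of _ n n _ n]) auto
  also have "\<dots> = (Y * A) * (X * A)" using X Y by simp
  also have "\<dots> = Y * (A * (X * A))"
    using A carr by (intro assoc_mult_mat[of _ n m _ n _ n]) auto
  also have "A * (X * A) = A * X * A"
    using A carr by (intro assoc_mult_mat[of _ m n _ m _ n, symmetric]) auto
  finally have XAY: "X * A = Y * A" using X by (simp only:)
  have "X = X * A * X" using X by (simp only:)
  also have "\<dots> = Y * (A * X)" unfolding XAY using A carr by (intro assoc_mult_mat[of _ n m _ n _ m]) auto
  also have "\<dots> = Y * A * Y" unfolding AXY using A carr by (intro assoc_mult_mat[of _ n m _ n _ m, symmetric]) auto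
  finally show ?thesis using Y by (simp only:)
qed

lemma moore_penrose_inverse_eq:
  "is_moore_penrose_inverse A X \<Longrightarrow> moore_penrose_inverse A = X"
  unfolding moore_penrose_inverse_def by (rule the_equality) (auto intro: moore_penrose_unique)

lemma mat_trace_mult_commute:
  assumes "P \<in> carrier_mat m n" "Q \<in> carrier_mat n m"
  shows "mat_trace (P * Q) = mat_trace (Q * P)"
proof -
  have "mat_trace (P * Q) = (\<Sum>i<m. \<Sum>j<n. P $$ (i, j) * Q $$ (j, i))"
    using assms by (simp add: mat_trace_def scalar_prod_def atLeast0LessThan)
  also have "\<dots> = (\<Sum>j<n. \<Sum>i<m. Q $$ (j, i) * P $$ (i, j))"
    by (subst sum.swap) (simp add: mult.commute)
  also have "\<dots> = mat_trace (Q * P)"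
    using assms by (simp add: mat_trace_def scalar_prod_def atLeast0LessThan)
  finally show ?thesis .
qed

definition diag_of :: "nat \<Rightarrow> (nat \<Rightarrow> real) \<Rightarrow> real mat" where
  "diag_of n f = mat n n (\<lambda>(i, j). if i = j then f i else 0)"

lemma diag_of_carrier [simp]: "diag_of n f \<in> carrier_mat n n"
  by (simp add: diag_of_def)

lemma diag_of_mult: "diag_of n f * diag_of n g = diag_of n (\<lambda>i. f i * g i)"
proof (rule eq_matI)
  fix i j assume "i < dim_row (diag_of n (\<lambda>i. f i * g i))" "j < dim_col (diag_of n (\<lambda>i. f i * g i))"
  then have ij: "i < n" "j < n" by (auto simp: diag_of_def)
  have "(diag_of n f * diag_of n g) $$ (i, j) =
     (\<Sum>k<n. (if i = k then f i else 0) * (if k = j then g k else 0))"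
    using ij by (simp add: diag_of_def scalar_prod_def atLeast0LessThan)
  also have "\<dots> = (\<Sum>k<n. if i = k then (if i = j then f i * g i else 0) else 0)"
    by (intro sum.cong) auto
  finally show "(diag_of n f * diag_of n g) $$ (i, j) = diag_of n (\<lambda>i. f i * g i) $$ (i, j)"
    using ij by (simp add: diag_of_def)
qed (auto simp: diag_of_def)

text \<open>
  Similar matrices have the same characteristic polynomial, so the sorted list of its roots is a
  permutation of the diagonal of \<open>D\<close>. Stating this for an arbitrary function \<open>h\<close> allows its use for the
  trace of the pseudo-inverse as well as, with an indicator function, for the sign of the eigenvalues.
\<close>
lemma sum_over_eigenvalues:
  assumes A: "A \<in> carrier_mat n n" and D: "D \<in> carrier_mat n n" "diagonal_mat D"
    and sim: "similar_mat A D"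
  shows "(\<Sum>i=1..n. h (nth_eigenvalue A i)) = (\<Sum>i<n. h (D $$ (i, i)) :: real)"
proof -
  define xs where "xs = sorted_list_of_multiset (proots (char_poly A))"
  have "upper_triangular D" using D by (auto simp: diagonal_mat_def upper_triangular_def)
  then have "char_poly A = (\<Prod>a\<leftarrow>diag_mat D. [:- a, 1:])"
    using char_poly_similar[OF sim] char_poly_upper_triangular[OF D(1)] by simp
  moreover have "(\<Prod>a\<leftarrow>ys. [:- a, 1:]) \<noteq> 0 \<and> proots (\<Prod>a\<leftarrow>ys. [:- a, 1:]) = mset ys"
    for ys :: "real list"
    by (induction ys) (auto simp: proots_mult simp del: mult_pCons_left)
  ultimately have "proots (char_poly A) = mset (diag_mat D)" by simp
  then have xs: "mset xs = mset (diag_mat D)" by (simp add: xs_def)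
  have diag: "diag_mat D = map (\<lambda>i. D $$ (i, i)) [0..<n]" using D by (simp add: diag_mat_def)
  have len: "length xs = n" using arg_cong[OF xs, of size] diag by simp
  have "(\<Sum>i=1..n. h (nth_eigenvalue A i)) = (\<Sum>i<n. h (xs ! i))"
    unfolding nth_eigenvalue_def xs_def[symmetric]
    by (rule sum.reindex_bij_witness[of _ Suc "\<lambda>i. i - 1"]) auto
  also have "\<dots> = sum_list (map h xs)"
    by (simp add: sum_list_sum_nth len atLeast0LessThan)
  also have "\<dots> = sum_list (map h (diag_mat D))"
    using arg_cong[OF xs, of "\<lambda>M. sum_mset (image_mset h M)"] by (simp add: sum_mset_sum_list flip: mset_map)
  also have "\<dots> = (\<Sum>i<n. h (D $$ (i, i)))"
    by (simp add: diag sum_list_sum_nth atLeast0LessThan)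
  finally show ?thesis .
qed

text \<open>
  In an orthonormal eigenbasis the pseudo-inverse inverts the nonzero diagonal entries and keeps the
  zeros. This is inversion of all entries with the convention \<open>inverse 0 = 0\<close>, so the trace formula
  needs no restriction to the nonzero eigenvalues.
\<close>
theorem symmetric_moore_penrose:
  fixes A :: "real mat"
  assumes A: "A \<in> carrier_mat n n" and sym: "transpose_mat A = A"
  shows "is_moore_penrose_inverse A (moore_penrose_inverse A)"
    and "transpose_mat (moore_penrose_inverse A) = moore_penrose_inverse A"
    and "mat_trace (moore_penrose_inverse A) = (\<Sum>i=1..n. inverse (nth_eigenvalue A i))"
proof -
  obtain U D where sim: "similar_mat_wit A D U (transpose_mat U)" and D: "diagonal_mat D"
    using real_symmetric_diagonalization[OF A sym] by blast
  note U = similar_mat_witD2[OF A sim]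
  define d where "d = (\<lambda>i. D $$ (i, i))"
  have Dd: "D = diag_of n d"
    using D U(5) by (intro eq_matI) (auto simp: diag_of_def d_def diagonal_mat_def)
  \<comment> \<open>\<open>f\<close> is the functional calculus of \<open>A\<close>; it turns pointwise products into matrix products.\<close>
  define f where "f = (\<lambda>g. U * diag_of n g * transpose_mat U)"
  have carr: "f g \<in> carrier_mat n n" for g using U by (auto simp: f_def)
  have mult: "f g * f h = f (\<lambda>i. g i * h i)" for g h
  proof -
    have "f g * f h = U * (diag_of n g * (transpose_mat U * U) * diag_of n h) * transpose_mat U"
      using U(6,7)
      by (simp add: f_def assoc_mult_mat[of _ n n _ n _ n] mult_carrier_mat[of _ n n _ n])
    then show ?thesis by (simp only: U(2) right_mult_one_mat[OF diag_of_carrier] diag_of_mult f_def)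
  qed
  have transp: "transpose_mat (f g) = f g" for g
  proof -
    have "transpose_mat (diag_of n g) = diag_of n g" by (rule eq_matI) (auto simp: diag_of_def)
    then show ?thesis
      using U(6,7) by (simp add: f_def transpose_mult[of _ n n _ n] assoc_mult_mat[of _ n n _ n _ n] mult_carrier_mat[of _ n n _ n])
  qed
  have Af: "A = f d" using U(3) by (simp add: f_def Dd)
  define X where "X = f (\<lambda>i. inverse (d i))"
  have cancel: "d i * inverse (d i) * d i = d i" "inverse (d i) * d i * inverse (d i) = inverse (d i)" for i
    by (cases "d i = 0"; simp)+
  have "is_moore_penrose_inverse A X"
    using carr[of d] carr[of "\<lambda>i. inverse (d i)"] unfolding is_moore_penrose_inverse_def
    by (simp add: Af X_def mult transp cancel)
  then have X: "moore_penrose_inverse A = X" by (rule moore_penrose_inverse_eq)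
  show "is_moore_penrose_inverse A (moore_penrose_inverse A)" unfolding X by fact
  show "transpose_mat (moore_penrose_inverse A) = moore_penrose_inverse A"
    unfolding X by (simp add: X_def transp)
  have "mat_trace X = mat_trace (transpose_mat U * (U * diag_of n (\<lambda>i. inverse (d i))))"
    unfolding X_def f_def using U(6,7) by (intro mat_trace_mult_commute[of _ n n]) auto
  also have "transpose_mat U * (U * diag_of n (\<lambda>i. inverse (d i))) = diag_of n (\<lambda>i. inverse (d i))"
  proof -
    have "transpose_mat U * (U * diag_of n (\<lambda>i. inverse (d i))) =
        (transpose_mat U * U) * diag_of n (\<lambda>i. inverse (d i))"
      using U(6,7) by (intro assoc_mult_mat[of _ n n _ n _ n, symmetric]) auto
    then show ?thesis by (simp only: U(2) left_mult_one_mat[OF diag_of_carrier])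
  qed
  also have "mat_trace (diag_of n (\<lambda>i. inverse (d i))) = (\<Sum>i<n. inverse (D $$ (i, i)))"
    by (simp add: mat_trace_def diag_of_def d_def)
  also have "\<dots> = (\<Sum>i=1..n. inverse (nth_eigenvalue A i))"
    using sim by (intro sum_over_eigenvalues[OF A U(5) D, symmetric]) (auto simp: similar_mat_def)
  finally show "mat_trace (moore_penrose_inverse A) = (\<Sum>i=1..n. inverse (nth_eigenvalue A i))"
    unfolding X .
qed

section \<open>The normalized Laplacian and its pseudo-inverse\<close>

text \<open>
  Contracting the matrix \<open>(e\<^sub>a - e\<^sub>b) (e\<^sub>a - e\<^sub>b)\<^sup>T\<close> with two vectors gives the product of their increments
  along the edge. The kernel of the Laplacian, the sign of its eigenvalues and the Gram representation of
  its pseudo-inverse are read off this identity for suitable \<open>X\<close> and \<open>Y\<close>.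
\<close>
lemma laplacian_congruence:
  assumes E: "simple_graph n E"
    and X: "X \<in> carrier_mat n n" and Y: "Y \<in> carrier_mat n n" and jk: "j < n" "k < n"
  shows "(transpose_mat X * normalized_laplacian n E L * Y) $$ (j, k) =
    1 / real (N_comp E L) *
      (\<Sum>((a, b), l)\<in>comparisons E L. (X $$ (a, j) - X $$ (b, j)) * (Y $$ (a, k) - Y $$ (b, k)))"
proof -
  define C where "C = comparisons E L"
  define w where "w = 1 / real (N_comp E L)"
  define u where "u = (\<lambda>(c :: comparison) p. (if p = fst (fst c) then 1 else 0) - (if p = snd (fst c) then 1 else 0 :: real))"
  have inC: "fst (fst c) < n" "snd (fst c) < n" if "c \<in> C" for c
    using that E by (auto simp: C_def comparisons_def simple_graph_def)
  have lap: "normalized_laplacian n E L $$ (p, q) = w * (\<Sum>c\<in>C. u c p * u c q)" if "p < n" "q < n" for p q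
  proof -
    have "(\<Sum>((a, b), l)\<in>C. (unit_vec n a - unit_vec n b) $ p * (unit_vec n a - unit_vec n b) $ q) = (\<Sum>c\<in>C. u c p * u c q)"
      using that inC by (intro sum.cong) (auto simp: u_def)
    then show ?thesis using that by (simp add: normalized_laplacian_def w_def C_def)
  qed
  have contract: "(\<Sum>p<n. u ((a, b), l) p * Z $$ (p, i)) = Z $$ (a, i) - Z $$ (b, i)"
    if "((a, b), l) \<in> C" for a b l i and Z :: "real mat"
  proof -
    have "(\<Sum>p<n. u ((a, b), l) p * Z $$ (p, i)) =
       (\<Sum>p<n. (if p = a then Z $$ (a, i) else 0) - (if p = b then Z $$ (b, i) else 0))"
      by (intro sum.cong) (auto simp: u_def)
    then show ?thesis using inC[OF that] by (simp add: sum_subtractf)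
  qed
  have "(transpose_mat X * normalized_laplacian n E L * Y) $$ (j, k) =
      (\<Sum>q<n. (\<Sum>p<n. X $$ (p, j) * (w * (\<Sum>c\<in>C. u c p * u c q))) * Y $$ (q, k))"
    using X Y jk lap by (simp add: scalar_prod_def atLeast0LessThan normalized_laplacian_def)
  also have "\<dots> = (\<Sum>q<n. \<Sum>p<n. \<Sum>c\<in>C. w * ((u c p * X $$ (p, j)) * (u c q * Y $$ (q, k))))"
    by (simp add: sum_distrib_left sum_distrib_right algebra_simps)
  also have "\<dots> = (\<Sum>c\<in>C. \<Sum>q<n. \<Sum>p<n. w * ((u c p * X $$ (p, j)) * (u c q * Y $$ (q, k))))"
    by (subst (2) sum.swap, subst sum.swap) (rule refl)
  also have "\<dots> = w * (\<Sum>c\<in>C. (\<Sum>p<n. u c p * X $$ (p, j)) * (\<Sum>q<n. u c q * Y $$ (q, k)))"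
    unfolding sum_distrib_left[of w _ C]
    by (intro sum.cong refl, subst sum.swap) (simp only: sum_product sum_distrib_left[of w])
  also have "(\<Sum>c\<in>C. (\<Sum>p<n. u c p * X $$ (p, j)) * (\<Sum>q<n. u c q * Y $$ (q, k))) =
      (\<Sum>((a, b), l)\<in>C. (X $$ (a, j) - X $$ (b, j)) * (Y $$ (a, k) - Y $$ (b, k)))"
    by (intro sum.cong) (auto simp: contract)
  finally show ?thesis by (simp add: w_def C_def)
qed

lemma laplacian_carrier [simp]: "normalized_laplacian n E L \<in> carrier_mat n n"
  by (simp add: normalized_laplacian_def)

lemma laplacian_symmetric: "transpose_mat (normalized_laplacian n E L) = normalized_laplacian n E L"
  by (rule eq_matI) (auto simp: normalized_laplacian_def intro!: sum.cong split: prod.splits)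

text \<open>
  If \<open>y\<close> is in the kernel, then \<open>y\<^sup>T M y\<close>, a sum of squared increments, vanishes. So \<open>y\<close> has no
  increment along any edge, and connectivity makes it constant.
\<close>
lemma laplacian_kernel_constant:
  assumes E: "simple_graph n E" and conn: "connected_graph n E" and L: "L \<ge> 1"
    and Y: "Y \<in> carrier_mat n n" and null: "normalized_laplacian n E L * Y = 0\<^sub>m n n"
    and ab: "a < n" "b < n" "k < n"
  shows "Y $$ (a, k) = Y $$ (b, k)"
proof -
  have edge: "Y $$ (a, k) = Y $$ (b, k)" if ab: "(a, b) \<in> E" for a b
  proof -
    have fin: "finite E" by (rule simple_graph_finite[OF E])
    then have "card E > 0" using ab by (auto simp: card_gt_0_iff)
    then have N: "real (N_comp E L) > 0" using L by (simp add: N_comp_def)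
    have "transpose_mat Y * normalized_laplacian n E L * Y = transpose_mat Y * (normalized_laplacian n E L * Y)"
      using Y by (intro assoc_mult_mat[of _ n n _ n _ n]) auto
    also have "\<dots> = 0\<^sub>m n n" unfolding null using Y by (intro right_mult_zero_mat[of _ n n]) auto
    finally have "(\<Sum>((a, b), l)\<in>comparisons E L. (Y $$ (a, k) - Y $$ (b, k)) * (Y $$ (a, k) - Y $$ (b, k))) = 0"
      using laplacian_congruence[OF E Y Y \<open>k < n\<close> \<open>k < n\<close>, of L] N \<open>k < n\<close> by simp
    then have "\<forall>c\<in>comparisons E L. (\<lambda>((a, b), l). (Y $$ (a, k) - Y $$ (b, k)) * (Y $$ (a, k) - Y $$ (b, k))) c = 0"
      by (subst (asm) sum_nonneg_eq_0_iff) (auto simp: simple_graph_finite_comparisons[OF E])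
    moreover have "((a, b), 0) \<in> comparisons E L" using ab L by (simp add: comparisons_def)
    ultimately show ?thesis by fastforce
  qed
  have "(a, b) \<in> (E \<union> E\<inverse>)\<^sup>*" using conn ab by (simp add: connected_graph_def)
  then show ?thesis by induction (auto simp: edge)
qed

lemma laplacian_trace:
  assumes E: "simple_graph n E" and N: "N_comp E L > 0"
  shows "mat_trace (normalized_laplacian n E L) = 2"
proof -
  have "mat_trace (normalized_laplacian n E L) =
     1 / real (N_comp E L) * (\<Sum>k<n. \<Sum>((a, b), l)\<in>comparisons E L. (unit_vec n a - unit_vec n b) $ k * (unit_vec n a - unit_vec n b) $ k)"
    by (simp add: mat_trace_def normalized_laplacian_def sum_distrib_left)
  also have "(\<Sum>k<n. \<Sum>((a, b), l)\<in>comparisons E L. (unit_vec n a - unit_vec n b) $ k * (unit_vec n a - unit_vec n b) $ k) =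
     (\<Sum>((a, b), l)\<in>comparisons E L. \<Sum>k<n. (unit_vec n a - unit_vec n b) $ k * (unit_vec n a - unit_vec n b :: real vec) $ k)"
    by (subst sum.swap) (simp add: case_prod_unfold)
  also have "\<dots> = (\<Sum>c\<in>comparisons E L. 2)"
  proof (intro sum.cong refl)
    fix c assume "c \<in> comparisons E L"
    then obtain a b l where c: "c = ((a, b), l)" "a < n" "b < n" "a \<noteq> b"
      using E by (fastforce simp: comparisons_def simple_graph_def)
    have "(\<Sum>k<n. (unit_vec n a - unit_vec n b) $ k * (unit_vec n a - unit_vec n b :: real vec) $ k) =
      (\<Sum>k<n. (if k = a then 1 else 0) + (if k = b then 1 else 0))"
      using c by (intro sum.cong) auto
    also have "\<dots> = 2" using c by (simp add: sum.distrib)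
    finally show "(case c of (x, l) \<Rightarrow> (case x of (a, b) \<Rightarrow> \<lambda>l. \<Sum>k<n. (unit_vec n a - unit_vec n b) $ k * (unit_vec n a - unit_vec n b :: real vec) $ k) l) = 2"
      by (simp add: c)
  qed
  also have "\<dots> = 2 * real (N_comp E L)" by (simp add: comparisons_def N_comp_def card_cartesian_product)
  finally show ?thesis using N by simp
qed

context
  fixes n :: nat and E :: "(nat \<times> nat) set" and L :: nat
    and M X :: "real mat"
  assumes n: "n \<ge> 2" and E: "simple_graph n E" and conn: "connected_graph n E" and L: "L \<ge> 1"
  defines "M \<equiv> normalized_laplacian n E L"
  defines "X \<equiv> moore_penrose_inverse M"
begin

lemma N_comp_pos: "real (N_comp E L) > 0"
proof -
  have "(0, 1) \<in> (E \<union> E\<inverse>)\<^sup>*" using conn n by (simp add: connected_graph_def)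
  then have "E \<noteq> {}" by (auto elim: converse_rtranclE)
  then show ?thesis using L simple_graph_finite[OF E] by (simp add: N_comp_def card_gt_0_iff)
qed

lemma laplacian_matrix: "M \<in> carrier_mat n n" "transpose_mat M = M"
  by (simp_all add: M_def laplacian_symmetric)

lemma pinv_identities: "X \<in> carrier_mat n n" "transpose_mat X = X" "M * X * M = M" "X * M * X = X"
    "transpose_mat (X * M) = X * M"
  using symmetric_moore_penrose(1,2)[OF laplacian_matrix] laplacian_matrix(1)
  by (auto simp: X_def is_moore_penrose_inverse_def)

lemma pinv_commutes: "M * X = X * M"
  using pinv_identities(5) transpose_mult[OF pinv_identities(1) laplacian_matrix(1)]
  by (simp only: pinv_identities(2) laplacian_matrix(2))

text \<open>
  Since \<open>X = X\<^sup>T M X\<close>, the pseudo-inverse is the Gram matrix of the increments of its own columns. This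
  supplies the energy of a column, the signs of the diagonal entries and a Cauchy-Schwarz inequality.
\<close>
lemma pinv_gram:
  assumes "j < n" "k < n"
  shows "real (N_comp E L) * X $$ (j, k) =
    (\<Sum>((a, b), l)\<in>comparisons E L. (X $$ (a, j) - X $$ (b, j)) * (X $$ (a, k) - X $$ (b, k)))"
  using laplacian_congruence[OF E pinv_identities(1) pinv_identities(1) assms, of L] N_comp_pos
  unfolding M_def[symmetric] pinv_identities(2) pinv_identities(4) by simp

text \<open>
  The all-ones vector has no increments, hence it is in the kernel of the symmetric matrix \<open>M\<close>.
\<close>
lemma ones_annihilated:
  assumes k: "k < n" and Y: "Y \<in> carrier_mat n n"
  shows "(\<Sum>j<n. (M * Y) $$ (j, k)) = 0"
proof -
  \<comment> \<open>The all-ones row vector, repeated to a square matrix so that \<open>laplacian_congruence\<close> applies.\<close>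
  define J where "J = mat n n (\<lambda>_. 1 :: real)"
  have J: "J \<in> carrier_mat n n" "transpose_mat J = J"
    by (auto simp: J_def intro!: eq_matI)
  have less: "a < n \<and> b < n" if "((a, b), l) \<in> comparisons E L" for a b l
    using that E by (auto simp: comparisons_def simple_graph_def)
  have "(J * (M * Y)) $$ (0, k) = (J * M * Y) $$ (0, k)"
    using J laplacian_matrix Y by (simp add: assoc_mult_mat[of _ n n _ n _ n])
  also have "\<dots> = 0"
  proof -
    have "(\<Sum>((a, b), l)\<in>comparisons E L. (J $$ (a, 0) - J $$ (b, 0)) * (Y $$ (a, k) - Y $$ (b, k))) = 0"
      by (intro sum.neutral) (use n in \<open>auto dest!: less simp: J_def\<close>)
    then show ?thesis
      using laplacian_congruence[OF E J(1) Y _ k, of 0 L] n by (simp add: J(2) M_def)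
  qed
  finally have "(J * (M * Y)) $$ (0, k) = 0" .
  then show ?thesis using laplacian_matrix Y k n by (simp add: J_def scalar_prod_def atLeast0LessThan del: assoc_mult_mat)
qed

lemma pinv_column_sum: "k < n \<Longrightarrow> (\<Sum>j<n. X $$ (j, k)) = 0"
proof -
  assume k: "k < n"
  have "X = M * (X * X)"
    using pinv_identities(4) laplacian_matrix pinv_identities(1)
    by (simp only: pinv_commutes[symmetric]) (simp add: assoc_mult_mat[of _ n n _ n _ n])
  then show ?thesis using ones_annihilated[OF k, of "X * X"] pinv_identities(1) by (metis mult_carrier_mat)
qed

text \<open>
  The matrix \<open>Q = 1 - X M\<close> is the orthogonal projection onto the kernel of \<open>M\<close>, which is spanned by the
  all-ones vector. Its columns are constant and it is symmetric, so all its entries agree; as \<open>X M\<close> has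
  vanishing column sums, each column of \<open>Q\<close> sums to \<open>1\<close>.
\<close>
lemma projection_trace: "mat_trace (X * M) = real n - 1"
proof -
  define Q where "Q = 1\<^sub>m n - X * M"
  have Q: "Q \<in> carrier_mat n n" using pinv_identities laplacian_matrix by (auto simp: Q_def)
  have "transpose_mat Q = Q"
    unfolding Q_def using pinv_identities(1) laplacian_matrix(1) pinv_identities(5) by (simp add: transpose_minus[of _ n n])
  then have symQ: "Q $$ (i, j) = Q $$ (j, i)" if "i < n" "j < n" for i j
    using that Q by (metis carrier_matD index_transpose_mat(1))
  have "M * Q = M * 1\<^sub>m n - M * (X * M)"
    unfolding Q_def using laplacian_matrix pinv_identities by (intro mult_minus_distrib_mat[of _ n n _ n]) auto
  also have "M * (X * M) = M"
    using pinv_identities(3) laplacian_matrix pinv_identities(1) by (simp add: assoc_mult_mat[of _ n n _ n _ n])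
  also have "M * 1\<^sub>m n - M = 0\<^sub>m n n" using laplacian_matrix by auto
  finally have null: "M * Q = 0\<^sub>m n n" .
  have const: "Q $$ (a, k) = Q $$ (b, k)" if "a < n" "b < n" "k < n" for a b k
    by (rule laplacian_kernel_constant[OF E conn L Q null[unfolded M_def] that])
  have diag: "Q $$ (k, k) = Q $$ (j, 0)" if "k < n" "j < n" for k j
    using const[of k 0 k] symQ[of 0 k] const[of k j 0] that n by simp
  have "mat_trace Q = (\<Sum>j<n. Q $$ (j, 0))"
    using Q by (auto simp: mat_trace_def intro!: sum.cong diag)
  also have "\<dots> = (\<Sum>j<n. 1\<^sub>m n $$ (j, 0)) - (\<Sum>j<n. (M * X) $$ (j, 0))"
    using laplacian_matrix pinv_identities n by (simp add: Q_def pinv_commutes sum_subtractf)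
  also have "\<dots> = 1"
    using ones_annihilated[of 0 X] pinv_identities(1) n by simp
  finally have "mat_trace Q = 1" .
  moreover have "mat_trace Q = real n - mat_trace (X * M)"
    using laplacian_matrix pinv_identities by (simp add: Q_def mat_trace_def sum_subtractf)
  ultimately show ?thesis by simp
qed

text \<open>
  The nonzero eigenvalues are \<open>n - 1\<close> positive numbers with sum \<open>2\<close>, so their inverses sum to at least
  \<open>(n - 1)\<^sup>2 / 2\<close>. In matrix form this is the nonnegativity of the trace of \<open>(X - t) M (X - t)\<close>, for
  the best choice of \<open>t\<close>.
\<close>
lemma pinv_trace_lower: "mat_trace X \<ge> (real n)\<^sup>2 / 8"
proof -
  \<comment> \<open>The value of \<open>t\<close> that maximizes \<open>2 t (n - 1) - 2 t\<^sup>2\<close>.\<close>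
  define t where "t = (real n - 1) / 2"
  have diag: "X $$ (k, k) - 2 * t * (X * M) $$ (k, k) + t\<^sup>2 * M $$ (k, k) \<ge> 0" if k: "k < n" for k
  proof -
    define D where "D = (\<lambda>(Z :: real mat) (c :: comparison). Z $$ (fst (fst c), k) - Z $$ (snd (fst c), k))"
    have form: "(transpose_mat Y * M * Z) $$ (k, k) = 1 / real (N_comp E L) * (\<Sum>c\<in>comparisons E L. D Y c * D Z c)"
      if "Y \<in> carrier_mat n n" "Z \<in> carrier_mat n n" for Y Z
      using laplacian_congruence[OF E that k k, of L] unfolding M_def[symmetric]
      by (simp add: D_def case_prod_unfold)
    have "X $$ (k, k) - 2 * t * (X * M) $$ (k, k) + t\<^sup>2 * M $$ (k, k) =
      1 / real (N_comp E L) * (\<Sum>c\<in>comparisons E L. (D X c - t * D (1\<^sub>m n) c)\<^sup>2)"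
      using form[OF pinv_identities(1) pinv_identities(1)] form[OF pinv_identities(1) one_carrier_mat]
        form[OF one_carrier_mat one_carrier_mat] laplacian_matrix(1) pinv_identities(1)
      by (simp add: pinv_identities(2,4) right_mult_one_mat[of _ n n] left_mult_one_mat[of _ n n] power2_eq_square algebra_simps
            sum.distrib sum_subtractf sum_distrib_left add_divide_distrib diff_divide_distrib)
    also have "\<dots> \<ge> 0" by (intro mult_nonneg_nonneg sum_nonneg) auto
    finally show ?thesis .
  qed
  have "0 \<le> (\<Sum>k<n. X $$ (k, k) - 2 * t * (X * M) $$ (k, k) + t\<^sup>2 * M $$ (k, k))"
    using diag by (intro sum_nonneg) auto
  also have "\<dots> = mat_trace X - 2 * t * mat_trace (X * M) + t\<^sup>2 * mat_trace M"
    using laplacian_matrix pinv_identities by (simp add: mat_trace_def sum.distrib sum_subtractf sum_distrib_left)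
  also have "\<dots> = mat_trace X - (real n - 1)\<^sup>2 / 2"
    using laplacian_trace[OF E, of L] N_comp_pos
    by (simp add: projection_trace t_def M_def[symmetric] power2_eq_square field_simps)
  finally have "mat_trace X \<ge> (real n - 1)\<^sup>2 / 2" by simp
  moreover have "(real n)\<^sup>2 \<le> (2 * (real n - 1))\<^sup>2" using n by (intro power_mono) auto
  moreover have "(2 * (real n - 1))\<^sup>2 = 4 * (real n - 1)\<^sup>2" by (simp add: power2_eq_square algebra_simps)
  ultimately show ?thesis by linarith
qed

lemma pinv_diag_nonneg: "k < n \<Longrightarrow> X $$ (k, k) \<ge> 0"
  using pinv_gram[of k k] N_comp_pos
  by (metis (no_types, lifting) sum_nonneg case_prod_unfold zero_le_square zero_le_mult_iff not_less)

lemma pinv_cauchy_schwarz: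
  assumes "j < n" "k < n"
  shows "(X $$ (j, k))\<^sup>2 \<le> X $$ (j, j) * X $$ (k, k)"
proof -
  define D where "D = (\<lambda>i (c :: comparison). X $$ (fst (fst c), i) - X $$ (snd (fst c), i))"
  have gram: "real (N_comp E L) * X $$ (i, j) = (\<Sum>c\<in>comparisons E L. D i c * D j c)"
    if "i < n" "j < n" for i j
    using pinv_gram[OF that] by (simp add: D_def case_prod_unfold)
  have "(real (N_comp E L) * X $$ (j, k))\<^sup>2 \<le>
      (real (N_comp E L) * X $$ (j, j)) * (real (N_comp E L) * X $$ (k, k))"
    using Cauchy_Schwarz_ineq_sum[of "D j" "D k" "comparisons E L"]
    by (simp add: gram assms power2_eq_square)
  then have "(real (N_comp E L))\<^sup>2 * (X $$ (j, k))\<^sup>2 \<le> (real (N_comp E L))\<^sup>2 * (X $$ (j, j) * X $$ (k, k))"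
    by (simp add: power2_eq_square algebra_simps)
  then show ?thesis using N_comp_pos by simp
qed

lemma pinv_diag_le_trace: "k < n \<Longrightarrow> X $$ (k, k) \<le> mat_trace X"
  unfolding mat_trace_def using pinv_identities(1) pinv_diag_nonneg
  by (intro member_le_sum[where f = "\<lambda>i. X $$ (i, i)"]) auto

text \<open>
  The diagonal entries of \<open>U\<^sup>T M U\<close> are values of a quadratic form that is a sum of squares. Counting
  negative entries with \<open>sum_over_eigenvalues\<close> transfers their sign to the sorted list.
\<close>
lemma eigenvalue_nonneg:
  assumes "1 \<le> i" "i \<le> n"
  shows "nth_eigenvalue M i \<ge> 0"
proof -
  obtain U D where sim: "similar_mat_wit M D U (transpose_mat U)" and D: "diagonal_mat D"
    using real_symmetric_diagonalization[OF laplacian_matrix] by blast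
  note U = similar_mat_witD2[OF laplacian_matrix(1) sim]
  have "D = transpose_mat U * M * U"
    using similar_mat_wit_sym[OF sim] by (auto simp: similar_mat_wit_def Let_def)
  then have "\<not> D $$ (k, k) < 0" if "k < n" for k
    using laplacian_congruence[OF E U(6) U(6) that that, of L]
    by (auto simp: M_def not_less intro!: divide_nonneg_nonneg sum_nonneg)
  then have "(\<Sum>i<n. if D $$ (i, i) < 0 then 1 else 0 :: real) = 0"
    by (intro sum.neutral) auto
  then have "(\<Sum>i=1..n. if nth_eigenvalue M i < 0 then 1 else 0 :: real) = 0"
    using sim by (subst sum_over_eigenvalues[OF laplacian_matrix(1) U(5) D]) (auto simp: similar_mat_def)
  then have "\<forall>i\<in>{1..n}. (if nth_eigenvalue M i < 0 then 1 else 0 :: real) = 0"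
    by (subst (asm) sum_nonneg_eq_0_iff) auto
  then show ?thesis using assms by (auto simp: not_less split: if_splits)
qed

text \<open>
  A block of inverse eigenvalues is a partial sum of the trace formula, whose terms are nonnegative.
\<close>
lemma eigenvalue_block_le_trace:
  assumes "1 \<le> i0" "m \<le> n"
  shows "(\<Sum>i=i0..m. inverse (nth_eigenvalue M i)) \<le> mat_trace X"
proof -
  have "mat_trace X = (\<Sum>i=1..n. inverse (nth_eigenvalue M i))"
    unfolding X_def by (rule symmetric_moore_penrose(3)[OF laplacian_matrix])
  moreover have "(\<Sum>i=i0..m. inverse (nth_eigenvalue M i)) \<le> (\<Sum>i=1..n. inverse (nth_eigenvalue M i))"
    using assms eigenvalue_nonneg by (intro sum_mono2) auto
  ultimately show ?thesis by simp
qed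

section \<open>The minimax lower bound\<close>

text \<open>
  Among the vectors \<open>v\<close> with zero sum and \<open>v\<^sup>T M v = 1\<close>, coordinate \<open>k\<close> is largest for a multiple of
  column \<open>k\<close> of \<open>X\<close>, where it equals \<open>sqrt (X\<^sub>k\<^sub>k)\<close>, by Cauchy-Schwarz for the form of \<open>M\<close>. The alternative
  to the parameter \<open>0\<close> is such a multiple for a diagonal entry \<open>X\<^sub>k\<^sub>k\<close>, that is at least the average \<open>tr X / n\<close>. The
  sample-size condition is what keeps \<open>v\<close> inside the cube of radius \<open>\<kappa>\<close>.
\<close>
lemma risk_lower_bound:
  assumes kappa: "\<kappa> > 0"
    and sample: "real (N_comp E L) \<ge> mat_trace X / (exp (2 * \<kappa>) * \<kappa>\<^sup>2)"
    and est: "\<And>y. est y \<in> carrier_vec n"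
  shows "\<exists>\<theta>\<in>param_space n \<kappa>.
    linf_risk E L est \<theta> \<ge> exp (- 2 * \<kappa>) * mat_trace X / (16 * real n * real (N_comp E L))"
proof -
  define N where "N = real (N_comp E L)"
  have N: "N > 0" using N_comp_pos by (simp add: N_def)
  obtain k where k: "k < n" and avg: "mat_trace X \<le> real n * X $$ (k, k)"
  proof -
    have "\<exists>k<n. mat_trace X \<le> real n * X $$ (k, k)"
    proof (rule ccontr)
      assume "\<not> ?thesis"
      then have "(\<Sum>k<n. real n * X $$ (k, k)) < (\<Sum>k<n. mat_trace X)"
        using n by (intro sum_strict_mono) (auto simp: not_le lessThan_empty_iff)
      then show False using pinv_identities(1) by (simp add: mat_trace_def flip: sum_distrib_left)
    qed
    then show ?thesis using that by blast
  qed
  have "real n * X $$ (k, k) > 0"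
    using avg pinv_trace_lower n by (smt (verit) of_nat_0_less_iff zero_less_power divide_pos_pos pos2 less_le_trans)
  then have Xk: "X $$ (k, k) > 0" using n by (simp add: zero_less_mult_iff)
  \<comment> \<open>Scaled so that the energy of \<open>v\<close> is \<open>exp (- 2 * \<kappa>)\<close>: a larger \<open>v\<close> could leave the parameter space.\<close>
  define s where "s = exp (- 2 * \<kappa>) / (N * X $$ (k, k))"
  define v where "v = vec n (\<lambda>j. sqrt s * X $$ (j, k))"
  have s: "s > 0" using N Xk by (simp add: s_def)
  have v: "v \<in> carrier_vec n" by (simp add: v_def)
  have vk: "(v $ k)\<^sup>2 = exp (- 2 * \<kappa>) * X $$ (k, k) / N"
    using k s N Xk by (simp add: v_def power_mult_distrib) (simp add: s_def power2_eq_square)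
  have "comparison_energy E L v = (\<Sum>((a, b), l)\<in>comparisons E L. s * ((X $$ (a, k) - X $$ (b, k)) * (X $$ (a, k) - X $$ (b, k))))"
    unfolding comparison_energy_def
  proof (intro sum.cong refl)
    fix c assume "c \<in> comparisons E L"
    then obtain a b l where c: "c = ((a, b), l)" "a < n" "b < n"
      using E by (fastforce simp: comparisons_def simple_graph_def)
    have "(v $ a - v $ b)\<^sup>2 = (sqrt s * (X $$ (a, k) - X $$ (b, k)))\<^sup>2"
      using c by (simp add: v_def algebra_simps)
    also have "\<dots> = s * ((X $$ (a, k) - X $$ (b, k)) * (X $$ (a, k) - X $$ (b, k)))"
      using s by (simp add: power_mult_distrib power2_eq_square)
    finally show "(case c of (x, l) \<Rightarrow> (case x of (a, b) \<Rightarrow> \<lambda>l. (v $ a - v $ b)\<^sup>2) l) =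
      (case c of (x, l) \<Rightarrow> (case x of (a, b) \<Rightarrow> \<lambda>l. s * ((X $$ (a, k) - X $$ (b, k)) * (X $$ (a, k) - X $$ (b, k)))) l)"
      by (simp add: c)
  qed
  also have "\<dots> = s * (N * X $$ (k, k))"
    using pinv_gram[OF k k] by (simp add: N_def sum_distrib_left case_prod_unfold)
  also have "\<dots> = exp (- 2 * \<kappa>)" using N Xk by (simp add: s_def)
  finally have energy: "comparison_energy E L v \<le> 4" using kappa by (smt (verit) one_le_exp_iff exp_le_one_iff)
  have "v \<in> param_space n \<kappa>"
  proof -
    have "vec n (\<lambda>_. 1) \<bullet> v = sqrt s * (\<Sum>j<n. X $$ (j, k))"
      by (simp add: v_def scalar_prod_def atLeast0LessThan sum_distrib_left)
    then have "vec n (\<lambda>_. 1) \<bullet> v = 0" by (simp add: pinv_column_sum[OF k])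
    moreover have "linf_norm v \<le> \<kappa>"
    proof (rule linf_norm_le)
      fix j assume "j < dim_vec v"
      then have j: "j < n" by (simp add: v_def)
      have "(v $ j)\<^sup>2 = s * (X $$ (j, k))\<^sup>2" using j s by (simp add: v_def power_mult_distrib)
      also have "\<dots> \<le> s * (X $$ (j, j) * X $$ (k, k))"
        using s pinv_cauchy_schwarz[OF j k] by (intro mult_left_mono) auto
      also have "\<dots> = exp (- 2 * \<kappa>) / N * X $$ (j, j)" using Xk by (simp add: s_def)
      also have "\<dots> \<le> exp (- 2 * \<kappa>) / N * mat_trace X"
        using pinv_diag_le_trace[OF j] N by (intro mult_left_mono) auto
      also have "\<dots> \<le> \<kappa>\<^sup>2"
      proof -
        have "mat_trace X \<le> N * (exp (2 * \<kappa>) * \<kappa>\<^sup>2)"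
          using sample kappa by (simp add: N_def pos_divide_le_eq)
        then have "exp (- 2 * \<kappa>) / N * mat_trace X \<le> exp (- 2 * \<kappa>) / N * (N * (exp (2 * \<kappa>) * \<kappa>\<^sup>2))"
          using N by (intro mult_left_mono) auto
        also have "\<dots> = \<kappa>\<^sup>2" using N by (simp add: exp_minus)
        finally show ?thesis .
      qed
      finally show "\<bar>v $ j\<bar> \<le> \<kappa>" using kappa by (intro abs_le_square_iff[THEN iffD2, of _ \<kappa>, simplified abs_of_pos[OF kappa]])
    qed (use n in \<open>simp add: v_def\<close>)
    ultimately show ?thesis using v by (simp add: param_space_def)
  qed
  moreover have "0\<^sub>v n \<in> param_space n \<kappa>"
  proof -
    have "linf_norm (0\<^sub>v n) \<le> \<kappa>" using n kappa by (intro linf_norm_le) auto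
    then show ?thesis by (simp add: param_space_def)
  qed
  moreover have "exp (- 2 * \<kappa>) * mat_trace X / (16 * real n * N) \<le> (v $ k)\<^sup>2 / 16"
  proof -
    have "exp (- 2 * \<kappa>) * mat_trace X / (16 * real n * N) \<le> exp (- 2 * \<kappa>) * (real n * X $$ (k, k)) / (16 * real n * N)"
      using N avg by (intro divide_right_mono mult_left_mono) auto
    also have "\<dots> = (v $ k)\<^sup>2 / 16" unfolding vk using n by simp
    finally show ?thesis .
  qed
  moreover have "(v $ k)\<^sup>2 / 8 \<le> linf_risk E L est (0\<^sub>v n) + linf_risk E L est v"
    by (rule BTL_two_point_risk[OF E est v k energy])
  then have "(v $ k)\<^sup>2 / 16 \<le> linf_risk E L est (0\<^sub>v n) \<or> (v $ k)\<^sup>2 / 16 \<le> linf_risk E L est v"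
    by linarith
  ultimately show ?thesis unfolding N_def[symmetric] by (meson order_trans)
qed

end

text \<open>
  Both terms of the maximum are at most \<open>8 tr X\<close>: the first by \<open>pinv_trace_lower\<close>, the second because
  each block of inverse eigenvalues is part of the trace. With \<open>risk_lower_bound\<close> this gives the
  constants \<open>c2 = 1\<close> and \<open>c = 1 / (16 * 8)\<close>.
\<close>
theorem theorem5:
  shows "\<exists>c2 > 0. \<exists>c > 0.
    \<forall>(n::nat) (E :: (nat \<times> nat) set) (L::nat) (\<kappa>::real)
      (est :: (comparison \<Rightarrow> bool) \<Rightarrow> real vec).
      n \<ge> 2 \<longrightarrow> simple_graph n E \<longrightarrow> connected_graph n E \<longrightarrow> L \<ge> 1 \<longrightarrow> \<kappa> > 0 \<longrightarrow>
      real (N_comp E L) \<ge>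
        c2 * mat_trace (moore_penrose_inverse (normalized_laplacian n E L)) /
        (exp (2 * \<kappa>) * \<kappa>\<^sup>2) \<longrightarrow>
      (\<forall>y. est y \<in> carrier_vec n) \<longrightarrow>
      (SUP \<theta>\<in>param_space n \<kappa>. ereal (linf_risk E L est \<theta>)) \<ge>
        ereal (c * (exp (- 2 * \<kappa>) / (real n * real (N_comp E L)) *
          max ((real n)\<^sup>2)
            (Max ((\<lambda>n'. \<Sum>i = nat \<lceil>0.99 * real n'\<rceil>..n'.
                     inverse (nth_eigenvalue (normalized_laplacian n E L) i)) ` {2..n}))))"
proof (rule exI[of _ 1], intro conjI, simp, rule exI[of _ "1 / 128"], intro conjI allI impI)
  fix n E L \<kappa> and est :: "(comparison \<Rightarrow> bool) \<Rightarrow> real vec"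
  assume n: "n \<ge> 2" and E: "simple_graph n E" and conn: "connected_graph n E" and L: "L \<ge> 1"
    and kappa: "\<kappa> > 0"
    and sample: "real (N_comp E L) \<ge>
        1 * mat_trace (moore_penrose_inverse (normalized_laplacian n E L)) / (exp (2 * \<kappa>) * \<kappa>\<^sup>2)"
    and est: "\<forall>y. est y \<in> carrier_vec n"
  let ?M = "normalized_laplacian n E L"
  define T where "T = mat_trace (moore_penrose_inverse ?M)"
  define N where "N = real (N_comp E L)"
  have N: "N > 0" using N_comp_pos[OF n E conn L] by (simp add: N_def)
  have block: "(\<Sum>i = nat \<lceil>0.99 * real n'\<rceil>..n'. inverse (nth_eigenvalue ?M i)) \<le> T"
    if "n' \<in> {2..n}" for n'
  proof -
    \<comment> \<open>The enumeration of the eigenvalues starts at \<open>1\<close>, so an index \<open>0\<close> has to be excluded.\<close>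
    have "1 \<le> nat \<lceil>0.99 * real n'\<rceil>" using that by auto linarith
    then show ?thesis using eigenvalue_block_le_trace[OF n E conn L] that by (auto simp: T_def)
  qed
  have lower: "(real n)\<^sup>2 \<le> 8 * T" using pinv_trace_lower[OF n E conn L] by (simp add: T_def)
  define S where "S = max ((real n)\<^sup>2)
            (Max ((\<lambda>n'. \<Sum>i = nat \<lceil>0.99 * real n'\<rceil>..n'. inverse (nth_eigenvalue ?M i)) ` {2..n}))"
  have "Max ((\<lambda>n'. \<Sum>i = nat \<lceil>0.99 * real n'\<rceil>..n'. inverse (nth_eigenvalue ?M i)) ` {2..n}) \<le> T"
    using n block by (subst Max_le_iff) auto
  moreover have "T \<ge> 0" using lower zero_le_power2[of "real n"] by linarith
  ultimately have S: "S \<le> 8 * T" using lower by (simp add: S_def)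
  obtain \<theta> where \<theta>: "\<theta> \<in> param_space n \<kappa>"
    and risk: "linf_risk E L est \<theta> \<ge> exp (- 2 * \<kappa>) * T / (16 * real n * N)"
    using risk_lower_bound[OF n E conn L kappa, of est] sample est by (auto simp: T_def N_def)
  have "1 / 128 * (exp (- 2 * \<kappa>) / (real n * N) * S) \<le> 1 / 128 * (exp (- 2 * \<kappa>) / (real n * N) * (8 * T))"
    using N S by (intro mult_left_mono) auto
  also have "\<dots> = exp (- 2 * \<kappa>) * T / (16 * real n * N)" by (simp add: ac_simps)
  also have "\<dots> \<le> linf_risk E L est \<theta>" by (rule risk)
  finally show "(SUP \<theta>\<in>param_space n \<kappa>. ereal (linf_risk E L est \<theta>)) \<ge>
        ereal (1 / 128 * (exp (- 2 * \<kappa>) / (real n * real (N_comp E L)) *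
          max ((real n)\<^sup>2)
            (Max ((\<lambda>n'. \<Sum>i = nat \<lceil>0.99 * real n'\<rceil>..n'.
                     inverse (nth_eigenvalue (normalized_laplacian n E L) i)) ` {2..n}))))"
    unfolding N_def S_def using \<theta> by (intro SUP_upper2[of \<theta>]) auto
qed simp

end
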